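(* Let $q$ be a prime power, let $k\ge 1$ and $n\ge 4k$ be integers, and let $V$ be an $n$-dimensional vector space over $\mathbb{F}_q$. Let $w:{V\brack 1}\to\mathbb{R}$ be a weighting of the one-dimensional subspaces of $V$ such that $\sum_{v\in{V\brack 1}} w(v)=0$. Then the number of $k$-dimensional subspaces $S$ of $V$ with $\sum_{v\in{V\brack 1},\,v\subset S} w(v)\ge 0$ is at least ${n-1\brack k-1}_q$.
   Context: ${V\brack k}$ denotes the family of all $k$-dimensional subspaces of $V$, and ${n\brack k}_q=\prod_{0\le i<k}\frac{q^{n-i}-1}{q^{k-i}-1}$ is the $q$-Gaussian binomial coefficient. *)

theory Defs
  imports "HOL-Analysis.Analysis" "HOL-Number_Theory.Prime_Powers"
begin

(* Since dim is 0 for subspaces without a finite basis, the dimension condition says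
   what it should for every k >= 1. *)
definition (in vector_space) subspaces_of_dim :: "'b set \<Rightarrow> nat \<Rightarrow> 'b set set"
  where "subspaces_of_dim V k = {S. subspace S \<and> S \<subseteq> V \<and> dim S = k}"

(* Only used for k <= n, where the truncated exponents n - i and k - i are the true ones. *)
definition gauss_binomial :: "nat \<Rightarrow> nat \<Rightarrow> nat \<Rightarrow> real"
  where "gauss_binomial q n k = (\<Prod>i<k. (real q ^ (n - i) - 1) / (real q ^ (k - i) - 1))"

end

theory Submission
  imports Defs
begin

text \<open>
  Write \<open>f S\<close> for the weight of a subspace \<open>S\<close>, \<open>D\<close> for the number of \<open>k\<close>-spaces through a point and
  \<open>r\<close> for the number of points of a \<open>k\<close>-space. Let \<open>v\<close> be a point of maximal weight. Either all
  \<open>D\<close> of the \<open>k\<close>-spaces through \<open>v\<close> are nonnegative, or one of them, \<open>B\<close>, is negative. In the second case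
  the \<open>f S\<close> with \<open>v \<in> S\<close> sum to almost \<open>D * w v\<close> while each is at most \<open>r * w v\<close>, which gives about
  \<open>D / r\<close> nonnegative \<open>k\<close>-spaces through \<open>v\<close>. Further ones are found among the \<open>k\<close>-spaces \<open>T\<close> meeting
  \<open>B\<close> trivially: if \<open>A\<close> has maximal weight among these, the sum of \<open>f T\<close> times the number of
  points of \<open>T \<inter> A\<close> is at least about \<open>D * f A\<close> because \<open>f B < 0\<close>. As \<open>f T \<le> f A\<close> and \<open>T \<inter> A\<close> rarely has more
  than one point, about \<open>D\<close> of the \<open>T\<close> are nonnegative, with a relative loss of order \<open>r\<^sup>3\<close> over the
  number of points of \<open>V\<close>. For \<open>n \<ge> 4 * k\<close> this loss is smaller than the gain \<open>D / r\<close>.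
  All sums run over nonzero vectors instead of points, so that a point is counted \<open>q - 1\<close> times.
\<close>

section \<open>Elementary inequalities and the Gaussian binomial coefficient\<close>

lemma card_field_ge_2: "CARD('f::{field,finite}) \<ge> 2"
proof -
  have "card {0, 1::'f} \<le> CARD('f)"
    by (rule card_mono) auto
  then show ?thesis by simp
qed

lemma finite_has_max_value:
  fixes f :: "'a \<Rightarrow> real"
  assumes "finite S" "S \<noteq> {}"
  obtains m where "m \<in> S" "\<And>x. x \<in> S \<Longrightarrow> f x \<le> f m"
proof -
  have "Max (f ` S) \<in> f ` S" using assms by (intro Max_in) auto
  then obtain m where "m \<in> S" "f m = Max (f ` S)" by auto
  then show ?thesis using that assms(1) by (metis Max_ge finite_imageI imageI)
qed

text \<open>Terms with \<open>f T < 0\<close> contribute at most 0, the others at most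
  \<open>M * y T\<close>. A lower bound for a weighted sum thus becomes one for its nonnegative
  members.\<close>

lemma sum_mult_indicator_bound:
  fixes f y :: "'a \<Rightarrow> real"
  assumes "finite E" "\<And>T. T \<in> E \<Longrightarrow> y T \<ge> 0" "\<And>T. T \<in> E \<Longrightarrow> f T \<le> M"
  shows "(\<Sum>T\<in>E. f T * y T) \<le> M * (\<Sum>T\<in>{T \<in> E. f T \<ge> 0}. y T)"
proof -
  have "(\<Sum>T\<in>E. f T * y T) \<le> (\<Sum>T\<in>E. if f T \<ge> 0 then M * y T else 0)"
    using assms(2,3) by (intro sum_mono) (auto intro: mult_right_mono mult_nonpos_nonneg)
  then show ?thesis using assms(1) by (simp add: sum.If_cases sum_distrib_left Int_def)
qed

text \<open>
  Here \<open>p\<close>, \<open>Q\<close>, \<open>X\<close> stand for \<open>q\<close>, \<open>q ^ k\<close>, \<open>q ^ n\<close>; the numbers of \<open>k\<close>-spaces through one and through two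
  points are \<open>D\<close> and \<open>L\<close>, and \<open>\<mu>\<close> and \<open>\<mu>'\<close> if only those meeting \<open>B\<close> trivially are counted.
\<close>

lemma count_bounds_combine:
  fixes p Q X D L \<mu> \<mu>' s t :: real
  assumes p: "p \<ge> 2" and Q: "Q > p" and X: "X \<ge> Q ^ 4"
    and L: "L \<ge> 0" "\<mu>' \<le> L" "D * (Q - p) = (X - p) * L"
    and \<mu>: "(D - \<mu>) * (p - 1) \<le> (Q - 1) * L"
    and s: "(D - L) * (p - 1) \<le> s * (Q - 1)"
    and t: "(p - 1)\<^sup>2 * (\<mu> - Q * \<mu>') - (Q - 1) * (Q - p) * \<mu>' \<le> t * (p - 1)\<^sup>2"
  shows "D \<le> s + t"
proof -
  \<comment> \<open>\<open>r\<close> and \<open>N\<close> are the numbers of points of a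
    \<open>k\<close>-space and of \<open>V\<close>; in these terms the hypotheses lose their factors
    \<open>p - 1\<close>.\<close>
  define r where "r = (Q - 1) / (p - 1)"
  define N where "N = (X - 1) / (p - 1)"
  have Qr: "Q - 1 = (p - 1) * r" and XN: "X - 1 = (p - 1) * N"
    using p by (simp_all add: r_def N_def)
  have r: "1 < r" "r \<le> Q"
  proof -
    show "1 < r" using p Q by (simp add: r_def)
    have "r * 1 \<le> r * (p - 1)" using \<open>1 < r\<close> p by (intro mult_left_mono) auto
    then show "r \<le> Q" using Qr by (simp add: mult.commute)
  qed
  have Qp: "Q - p = (p - 1) * (r - 1)" and Xp: "X - p = (p - 1) * (N - 1)"
    using Qr XN by (simp_all add: algebra_simps)
  have D: "D * (r - 1) = (N - 1) * L"
    using L(3) p unfolding Qp Xp by (simp add: mult_ac)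
  have \<mu>2: "D - \<mu> \<le> r * L"
  proof -
    have "(p - 1) * (D - \<mu>) \<le> (p - 1) * (r * L)" using \<mu> unfolding Qr by (simp add: mult_ac)
    then show ?thesis using p by simp
  qed
  have s2: "D - L \<le> s * r"
  proof -
    have "(p - 1) * (D - L) \<le> (p - 1) * (s * r)" using s unfolding Qr by (simp add: mult_ac)
    then show ?thesis using p by simp
  qed
  have t2: "\<mu> - Q * \<mu>' - r * (r - 1) * \<mu>' \<le> t"
  proof -
    have "(p - 1)\<^sup>2 * (\<mu> - Q * \<mu>' - r * (r - 1) * \<mu>') \<le> (p - 1)\<^sup>2 * t"
      using t unfolding Qr Qp by (simp add: algebra_simps power2_eq_square)
    then show ?thesis using p by simp
  qed
  \<comment> \<open>The assumption \<open>X \<ge> Q ^ 4\<close>, that is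
    \<open>n \<ge> 4 * k\<close>, enters here, by way of
    \<open>Q ^ 4 - 1 = (Q - 1) * (Q + 1) * (Q\<^sup>2 + 1)\<close>.\<close>
  have "N \<ge> r * ((Q + 1) * (Q\<^sup>2 + 1))"
  proof -
    have "(p - 1) * (r * ((Q + 1) * (Q\<^sup>2 + 1))) = Q ^ 4 - 1"
      unfolding mult.assoc[symmetric] Qr[symmetric]
      by (simp add: algebra_simps power2_eq_square power4_eq_xxxx)
    also have "\<dots> \<le> (p - 1) * N" using X XN by simp
    finally show ?thesis using p by simp
  qed
  moreover have "(r - 1) * (1 + r * Q + r ^ 3) \<le> r * ((Q + 1) * (Q\<^sup>2 + 1)) - 1"
  proof -
    have "r * Q \<le> Q\<^sup>2" "r ^ 3 \<le> Q ^ 3"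
      using r by (auto simp: power2_eq_square intro!: mult_right_mono power_mono)
    moreover have "(Q + 1) * (Q\<^sup>2 + 1) = Q ^ 3 + Q\<^sup>2 + Q + 1"
      by (simp add: algebra_simps power2_eq_square power3_eq_cube)
    ultimately have "1 + r * Q + r ^ 3 \<le> (Q + 1) * (Q\<^sup>2 + 1)"
      using r by linarith
    then have "(r - 1) * (1 + r * Q + r ^ 3) \<le> (r - 1) * ((Q + 1) * (Q\<^sup>2 + 1))"
      using r by (intro mult_left_mono) auto
    moreover have "1 \<le> (Q + 1) * (Q\<^sup>2 + 1)"
      using r mult_mono[of 1 "Q + 1" 1 "Q\<^sup>2 + 1"] by simp
    ultimately show ?thesis by (simp add: algebra_simps)
  qed
  ultimately have "(r - 1) * (1 + r * Q + r ^ 3) * L \<le> (N - 1) * L"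
    using L(1) by (intro mult_right_mono) auto
  then have "(r - 1) * ((1 + r * Q + r ^ 3) * L) \<le> (r - 1) * D"
    using D by (simp add: mult_ac)
  \<comment> \<open>Exactly what is needed: \<open>r * s\<close> is at least \<open>D - L\<close>
    and \<open>r * t\<close> is at least \<open>r * D - (r * Q + r ^ 3) * L\<close>, so the gain has
    to cover \<open>(1 + r * Q + r ^ 3) * L\<close>.\<close>
  then have key: "(1 + r * Q + r ^ 3) * L \<le> D" using r by simp
  have "(Q + r * (r - 1)) * \<mu>' \<le> (Q + r * (r - 1)) * L"
    using r by (intro mult_left_mono L(2)) auto
  then have "D - (r + Q + r * (r - 1)) * L \<le> t"
    using t2 \<mu>2 by (simp add: algebra_simps)
  then have "r * (D - (r + Q + r * (r - 1)) * L) \<le> r * t"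
    using r by (intro mult_left_mono) auto
  then have "r * D \<le> r * (s + t)"
    using s2 key by (simp add: algebra_simps power3_eq_cube)
  then show ?thesis using r by simp
qed

text \<open>A power of \<open>q\<close> cancels in each quotient after an index shift by one. The
  right-hand side is the form in which double counting yields the number of \<open>k\<close>-spaces
  through a point.\<close>

lemma gauss_binomial_eq_prod:
  assumes "1 \<le> k" "k \<le> n" "q \<ge> 2"
  shows "gauss_binomial q (n - 1) (k - 1)
       = (\<Prod>i=1..<k. (real q ^ n - real q ^ i) / (real q ^ k - real q ^ i))"
proof -
  obtain k' where k: "k = Suc k'" using assms(1) by (cases k) auto
  have "(real q ^ n - real q ^ Suc i) / (real q ^ k - real q ^ Suc i)
      = (real q ^ (n - 1 - i) - 1) / (real q ^ (k - 1 - i) - 1)" if "i < k'" for i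
  proof -
    have "real q ^ m - real q ^ Suc i = real q ^ Suc i * (real q ^ (m - 1 - i) - 1)" if "m \<ge> Suc i" for m
      using that by (simp add: right_diff_distrib power_add[symmetric] flip: power_Suc)
    from this[of n] this[of k] show ?thesis using \<open>i < k'\<close> assms k by simp
  qed
  then show ?thesis
    unfolding gauss_binomial_def k One_nat_def prod.shift_bounds_Suc_ivl
    by (auto simp: atLeast0LessThan k intro!: prod.cong)
qed

section \<open>Cardinalities of subspaces over a finite field\<close>

locale finite_field_space = vector_space scale
  for scale :: "'f::{field,finite} \<Rightarrow> 'v::ab_group_add \<Rightarrow> 'v"
begin


lemma card_span_singleton:
  assumes "x \<noteq> 0"
  shows "card (span {x}) = CARD('f)"
proof -
  have "inj (\<lambda>c. scale c x)"
    using assms by (auto intro!: injI)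
  then show ?thesis by (simp add: span_singleton card_image)
qed

lemma bij_betw_direct_sum:
  assumes "subspace U" "subspace B" "U \<inter> B = {0}"
  shows "bij_betw (\<lambda>(x, y). x + y) (U \<times> B) (span (U \<union> B))"
proof -
  have "x = x' \<and> y = y'" if "x \<in> U" "x' \<in> U" "y \<in> B" "y' \<in> B" "x + y = x' + y'" for x x' y y'
  proof -
    have "x - x' = y' - y" using that by (simp add: algebra_simps)
    moreover have "x - x' \<in> U" "y' - y \<in> B"
      using that assms(1,2) by (simp_all add: subspace_diff)
    ultimately have "x - x' \<in> U \<inter> B" by simp
    then have "x - x' = 0" unfolding assms(3) by simp
    then show ?thesis using that by simp
  qed
  moreover have "span (U \<union> B) = (\<lambda>(x, y). x + y) ` (U \<times> B)"
  proof -
    have "span U = U" "span B = B" using assms by simp_all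
    then show ?thesis unfolding span_Un by (simp add: image_def set_eq_iff Bex_def) metis
  qed
  ultimately show ?thesis
    unfolding bij_betw_def inj_on_def by (simp add: Ball_def) blast
qed

lemma card_direct_sum:
  assumes "subspace U" "subspace B" "U \<inter> B = {0}"
  shows "card (span (U \<union> B)) = card U * card B"
  using bij_betw_same_card[OF bij_betw_direct_sum[OF assms]] by (simp add: card_cartesian_product)

lemma scale_in_subspaceD:
  assumes "subspace S" "scale c x \<in> S" "c \<noteq> 0"
  shows "x \<in> S"
proof -
  have "scale (inverse c) (scale c x) \<in> S" using assms(1,2) by (rule subspace_scale)
  then show ?thesis using assms(3) by simp
qed

lemma span_singleton_meets_iff:
  assumes "subspace B" "x \<noteq> 0"
  shows "span {x} \<inter> B = {0} \<longleftrightarrow> x \<notin> B"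
proof
  assume "span {x} \<inter> B = {0}"
  then show "x \<notin> B" using assms(2) span_base[of x "{x}"] by auto
next
  assume x: "x \<notin> B"
  have "c = 0" if "scale c x \<in> B" for c
    using scale_in_subspaceD[OF assms(1) that] x by metis
  then show "span {x} \<inter> B = {0}"
    using subspace_0[OF assms(1)] by (auto simp: span_singleton)
qed

lemma card_span_insert:
  assumes "x \<notin> span U"
  shows "card (span (insert x U)) = CARD('f) * card (span U)"
proof -
  have x0: "x \<noteq> 0" using assms span_zero by auto
  have "span (insert x U) = span (span {x} \<union> span U)"
    unfolding insert_is_Un[of x U] span_Un span_span ..
  then show ?thesis
    using assms x0 by (simp add: card_direct_sum span_singleton_meets_iff card_span_singleton)
qed

lemma card_span_independent:
  assumes "finite B" "independent B"
  shows "card (span B) = CARD('f) ^ card B"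
  using assms
proof (induction B)
  case empty
  then show ?case by simp
next
  case (insert x B)
  then show ?case by (simp add: independent_insert card_span_insert)
qed

text \<open>An infinite basis would have \<open>card\<close> equal to 0, so positive dimension
  already forces a finite basis.\<close>

lemma card_subspace_dim_pos:
  assumes "subspace S" "dim S > 0"
  shows "card S = CARD('f) ^ dim S"
proof -
  obtain B where B: "B \<subseteq> S" "independent B" "S \<subseteq> span B" "card B = dim S"
    using basis_exists by metis
  have "finite B" using B(4) assms(2) card.infinite by fastforce
  moreover have "span B = S" using B assms(1) span_subspace by blast
  ultimately show ?thesis using card_span_independent B by metis
qed

lemma card_subspace:
  assumes "subspace S" "finite S"
  shows "card S = CARD('f) ^ dim S"
proof -
  obtain B where B: "B \<subseteq> S" "independent B" "S \<subseteq> span B" "card B = dim S"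
    using basis_exists by metis
  have "finite B" using B(1) assms(2) finite_subset by blast
  moreover have "span B = S" using B assms(1) span_subspace by blast
  ultimately show ?thesis using card_span_independent B by metis
qed

text \<open>Since \<open>CARD('f) \<ge> 2\<close>, cardinality determines dimension; the counting
  below uses cardinalities only.\<close>

lemma subspaces_of_dim_eq:
  assumes "finite V"
  shows "subspaces_of_dim V k = {S. subspace S \<and> S \<subseteq> V \<and> card S = CARD('f) ^ k}"
proof -
  have "dim S = k \<longleftrightarrow> card S = CARD('f) ^ k" if "subspace S" "S \<subseteq> V" for S
    using card_subspace[OF that(1)] finite_subset[OF that(2) assms] card_field_ge_2[where 'f='f]
    by (auto dest: power_inject_exp[THEN iffD1, rotated])
  then show ?thesis unfolding subspaces_of_dim_def by blast
qed

subsection \<open>Counting subspaces that extend a subspace and avoid another\<close>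

text \<open>\<open>U\<close> is an arbitrary set of vectors, so requiring one more vector amounts to
  an \<open>insert\<close>. Taking \<open>B = {0}\<close> gives all \<open>k\<close>-spaces
  containing \<open>U\<close>.\<close>

definition extensions :: "'v set \<Rightarrow> 'v set \<Rightarrow> nat \<Rightarrow> 'v set \<Rightarrow> 'v set set" where
  "extensions V B k U = {T. subspace T \<and> U \<subseteq> T \<and> T \<subseteq> V \<and> T \<inter> B = {0} \<and> card T = CARD('f) ^ k}"

text \<open>The exponents \<open>n\<close>, \<open>b\<close> and \<open>j\<close> are the dimensions of \<open>V\<close>, \<open>B\<close> and \<open>span U\<close>.\<close>

definition ext_count :: "nat \<Rightarrow> nat \<Rightarrow> nat \<Rightarrow> nat \<Rightarrow> real" where
  "ext_count n b k j = (\<Prod>i=j..<k. (real CARD('f) ^ n - real CARD('f) ^ (b + i)) / (real CARD('f) ^ k - real CARD('f) ^ i))"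

lemma finite_extensions: "finite V \<Longrightarrow> finite (extensions V B k U)"
  by (rule finite_subset[of _ "Pow V"]) (auto simp: extensions_def)

lemma extensions_containing: "{T \<in> extensions V B k U. x \<in> T} = extensions V B k (insert x U)"
  by (auto simp: extensions_def)

lemma power_q_less: "i < k \<Longrightarrow> real CARD('f) ^ i < real CARD('f) ^ k"
  using card_field_ge_2[where 'f='f] by (intro power_strict_increasing) auto

lemma ext_count_Suc:
  assumes "j < k"
  shows "ext_count n b k j * (real CARD('f) ^ k - real CARD('f) ^ j)
       = (real CARD('f) ^ n - real CARD('f) ^ (b + j)) * ext_count n b k (Suc j)"
  using assms power_q_less[OF assms] by (simp add: ext_count_def prod.atLeast_Suc_lessThan)

text \<open>A vector of \<open>B\<close> in the larger span differs from some
  \<open>scale c x\<close> by an element of \<open>span U\<close>. Then \<open>scale c x\<close>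
  lies in \<open>span (U \<union> B)\<close>, which forces \<open>c = 0\<close>.\<close>

lemma span_insert_disjoint:
  assumes "subspace B" "span U \<inter> B = {0}" "x \<notin> span (U \<union> B)"
  shows "span (insert x U) \<inter> B = {0}"
proof -
  have "y = 0" if y: "y \<in> span (insert x U)" "y \<in> B" for y
  proof -
    obtain c where c: "y - scale c x \<in> span U" using y(1) unfolding span_breakdown_eq by blast
    have d: "y - scale c x \<in> span (U \<union> B)" using span_mono[of U "U \<union> B"] c by blast
    have "y \<in> span (U \<union> B)" using y(2) span_base by auto
    from subspace_diff[OF subspace_span this d]
    have "y - (y - scale c x) \<in> span (U \<union> B)" .
    moreover have "y - (y - scale c x) = scale c x" by simp
    ultimately have "scale c x \<in> span (U \<union> B)" by metis
    then have "c = 0"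
      using assms(3) scale_in_subspaceD[of "span (U \<union> B)" c x] by auto
    then have "y \<in> span U \<inter> B" using c y(2) by simp
    then show ?thesis unfolding assms(2) by simp
  qed
  then show ?thesis using span_zero subspace_0[OF assms(1)] by auto
qed

text \<open>An instance of the modular law: the \<open>B\<close>-component of a vector of
  \<open>T\<close> in this span lies in \<open>T \<inter> B\<close>.\<close>

lemma inter_span_Un:
  assumes "subspace B" "subspace T" "T \<inter> B = {0}" "U \<subseteq> T"
  shows "T \<inter> span (U \<union> B) = span U"
proof
  have UT: "span U \<subseteq> T" by (rule span_minimal[OF assms(4,2)])
  then show "span U \<subseteq> T \<inter> span (U \<union> B)"
    using span_mono[of U "U \<union> B"] by blast
  show "T \<inter> span (U \<union> B) \<subseteq> span U"
  proof
    fix x assume "x \<in> T \<inter> span (U \<union> B)"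
    then have x: "x \<in> T" "x \<in> span (U \<union> B)" by simp_all
    have sB: "span B = B" using assms(1) by simp
    obtain u y where uy: "x = u + y" "u \<in> span U" "y \<in> B"
      using x(2) unfolding span_Un sB by blast
    have "x - u \<in> T" by (rule subspace_diff[OF assms(2) x(1) subsetD[OF UT uy(2)]])
    then have "y \<in> T \<inter> B" using uy by simp
    then show "x \<in> span U" using uy assms(3) by simp
  qed
qed

text \<open>Double counting of the pairs \<open>(x, T)\<close> with \<open>x \<in> T - span U\<close>, from dimension \<open>k\<close> downwards.\<close>

lemma card_extensions:
  assumes "finite V" "subspace V" "subspace B" "B \<subseteq> V" "U \<subseteq> V" "span U \<inter> B = {0}"
    and "card V = CARD('f) ^ n" "card B = CARD('f) ^ b" "card (span U) = CARD('f) ^ j" "j \<le> k"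
  shows "real (card (extensions V B k U)) = ext_count n b k j"
  using \<open>j \<le> k\<close> \<open>U \<subseteq> V\<close> \<open>span U \<inter> B = {0}\<close> \<open>card (span U) = CARD('f) ^ j\<close>
proof (induction j arbitrary: U rule: inc_induct)
  case base
  note base = base.prems
  have UV: "span U \<subseteq> V" by (rule span_minimal[OF base(1) assms(2)])
  have "T = span U" if "T \<in> extensions V B k U" for T
  proof -
    have "span U \<subseteq> T" using that by (intro span_minimal) (auto simp: extensions_def)
    moreover have "finite T" using that assms(1) finite_subset by (auto simp: extensions_def)
    ultimately show ?thesis
      using that base(3) card_subset_eq[of T "span U"] by (simp add: extensions_def)
  qed
  moreover have "span U \<in> extensions V B k U"
    using base UV span_superset by (auto simp: extensions_def)
  ultimately have "extensions V B k U = {span U}" by blast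
  then show ?case by (simp add: ext_count_def)
next
  case (step j)
  define E where "E = extensions V B k U"
  \<comment> \<open>By the modular law a vector of \<open>W - span U\<close> lies in no
    \<open>T\<close>, while each vector outside \<open>W\<close> can be added to \<open>U\<close>
    and falls under the induction hypothesis.\<close>
  define W where "W = span (U \<union> B)"
  have W: "W = span (span U \<union> B)"
    unfolding W_def span_Un span_span ..
  have WV: "W \<subseteq> V" unfolding W_def
    by (rule span_minimal) (use step.prems assms in auto)
  have fin: "finite E" unfolding E_def by (rule finite_extensions[OF assms(1)])
  have cW: "card W = CARD('f) ^ (b + j)"
    unfolding W using step.prems assms by (simp add: card_direct_sum power_add)
  have UW: "span U \<subseteq> W" unfolding W_def by (simp add: span_mono)
  have next_count: "real (card (extensions V B k (insert x U))) = ext_count n b k (Suc j)"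
    if x: "x \<in> V - W" for x
  proof (rule step.IH)
    show "insert x U \<subseteq> V" using step.prems x by auto
    have xU: "x \<notin> span U" using x UW by auto
    show "card (span (insert x U)) = CARD('f) ^ Suc j"
      using card_span_insert[OF xU] step.prems by simp
    show "span (insert x U) \<inter> B = {0}"
      using span_insert_disjoint[OF assms(3) step.prems(2)] x by (simp add: W_def)
  qed
  have diff: "{x \<in> V - W. x \<in> T} = T - span U" if "T \<in> E" for T
  proof -
    have T: "subspace T" "T \<subseteq> V" "T \<inter> B = {0}" "U \<subseteq> T"
      using that by (auto simp: E_def extensions_def)
    show ?thesis
      using inter_span_Un[OF assms(3) T(1,3,4)] T(2) unfolding W_def by blast
  qed
  have "(\<Sum>x\<in>V - W. real (card {T \<in> E. x \<in> T})) = (\<Sum>T\<in>E. real (card {x \<in> V - W. x \<in> T}))"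
    using sum.swap_restrict[of "V - W" E "\<lambda>_ _. 1::real" "\<lambda>x T. x \<in> T"] fin assms(1) by simp
  moreover have "(\<Sum>x\<in>V - W. real (card {T \<in> E. x \<in> T}))
      = (real CARD('f) ^ n - real CARD('f) ^ (b + j)) * ext_count n b k (Suc j)"
  proof -
    have "real (card (V - W)) = real CARD('f) ^ n - real CARD('f) ^ (b + j)"
      using cW assms(7) card_Diff_subset[OF finite_subset[OF WV assms(1)] WV] card_mono[OF assms(1) WV]
      by (simp add: of_nat_diff)
    then show ?thesis
      by (simp add: E_def extensions_containing next_count)
  qed
  moreover have "(\<Sum>T\<in>E. real (card {x \<in> V - W. x \<in> T})) = real (card E) * (real CARD('f) ^ k - real CARD('f) ^ j)"
  proof -
    have "real (card {x \<in> V - W. x \<in> T}) = real CARD('f) ^ k - real CARD('f) ^ j" if T: "T \<in> E" for T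
    proof -
      have T': "subspace T" "U \<subseteq> T" "T \<subseteq> V" and c: "card T = CARD('f) ^ k"
        using T by (auto simp: E_def extensions_def)
      have sub: "span U \<subseteq> T" by (rule span_minimal[OF T'(2,1)])
      have ft: "finite T" by (rule finite_subset[OF T'(3) assms(1)])
      show ?thesis
        unfolding diff[OF T]
        using card_Diff_subset[OF finite_subset[OF sub ft] sub] card_mono[OF ft sub] c step.prems
        by (simp add: of_nat_diff)
    qed
    then show ?thesis by simp
  qed
  ultimately show ?case
    using ext_count_Suc[OF \<open>j < k\<close>, of n b] power_q_less[OF \<open>j < k\<close>] unfolding E_def by simp
qed

subsection \<open>Sums of weights over subspaces\<close>

text \<open>Vectors of the direct sum are uniquely \<open>x + y\<close>; those with
  \<open>x = 0\<close> make up the sum over \<open>B\<close>.\<close>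

lemma sum_span_Un:
  fixes \<omega> :: "'v \<Rightarrow> real"
  assumes "subspace U" "subspace B" "U \<inter> B = {0}" "finite U"
  shows "sum \<omega> (span (U \<union> B)) - sum \<omega> B = (\<Sum>x\<in>U - {0}. \<Sum>y\<in>B. \<omega> (x + y))"
proof -
  have "sum \<omega> (span (U \<union> B)) = (\<Sum>(x, y)\<in>U \<times> B. \<omega> (x + y))"
    using sum.reindex_bij_betw[OF bij_betw_direct_sum[OF assms(1-3)], of \<omega>]
    by (simp add: case_prod_unfold)
  also have "\<dots> = (\<Sum>x\<in>U. \<Sum>y\<in>B. \<omega> (x + y))"
    by (simp add: sum.cartesian_product)
  also have "\<dots> = (\<Sum>y\<in>B. \<omega> y) + (\<Sum>x\<in>U - {0}. \<Sum>y\<in>B. \<omega> (x + y))"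
    using sum.remove[OF assms(4) subspace_0[OF assms(1)], of "\<lambda>x. \<Sum>y\<in>B. \<omega> (x + y)"] by simp
  finally show ?thesis by simp
qed

lemma mem_span_singleton_commute:
  assumes "x \<noteq> 0" "y \<noteq> 0"
  shows "y \<in> span {x} \<longleftrightarrow> x \<in> span {y}"
proof -
  have "x \<in> span {y}" if y: "y \<in> span {x}" "y \<noteq> 0" for x y
  proof -
    obtain c where c: "y = scale c x" using y(1) by (auto simp: span_singleton)
    then have "scale c x \<in> span {y}" "c \<noteq> 0" using y span_base[of y "{y}"] by auto
    then show ?thesis by (rule scale_in_subspaceD[OF subspace_span])
  qed
  then show ?thesis using assms by blast
qed

lemma card_subspace_minus_0:
  assumes "subspace S" "finite S"
  shows "real (card (S - {0})) = real (card S) - 1"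
  using card_Suc_Diff1[OF assms(2) subspace_0[OF assms(1)]] by linarith

lemma finite_span_singleton: "finite (span {x})"
  by (simp add: span_singleton)

text \<open>A nonzero \<open>y\<close> is counted once for every nonzero \<open>x\<close> on its own
  line, hence \<open>CARD('f) - 1\<close> times.\<close>

lemma sum_over_lines:
  fixes g :: "'v \<Rightarrow> real"
  assumes "subspace S" "finite S"
  shows "(\<Sum>x\<in>S - {0}. \<Sum>y\<in>span {x} - {0}. g y) = (real CARD('f) - 1) * (\<Sum>y\<in>S - {0}. g y)"
proof -
  have line: "span {x} \<subseteq> S" if "x \<in> S" for x
    using that by (intro span_minimal[OF _ assms(1)]) simp
  have "(\<Sum>x\<in>S - {0}. \<Sum>y\<in>span {x} - {0}. g y)
      = (\<Sum>x\<in>S - {0}. \<Sum>y\<in>{y \<in> S - {0}. y \<in> span {x}}. g y)"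
  proof (rule sum.cong[OF refl])
    fix x assume "x \<in> S - {0}"
    then have "span {x} - {0} = {y \<in> S - {0}. y \<in> span {x}}" using line by blast
    then show "(\<Sum>y\<in>span {x} - {0}. g y) = (\<Sum>y\<in>{y \<in> S - {0}. y \<in> span {x}}. g y)" by simp
  qed
  also have "\<dots> = (\<Sum>y\<in>S - {0}. \<Sum>x\<in>{x \<in> S - {0}. y \<in> span {x}}. g y)"
    using assms(2) by (intro sum.swap_restrict) auto
  also have "\<dots> = (\<Sum>y\<in>S - {0}. (real CARD('f) - 1) * g y)"
  proof (rule sum.cong[OF refl])
    fix y assume y: "y \<in> S - {0}"
    then have "{x \<in> S - {0}. y \<in> span {x}} = span {y} - {0}"
      using line[of y] mem_span_singleton_commute[of _ y] by blast
    moreover have "real (card (span {y} - {0})) = real CARD('f) - 1"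
      using y card_subspace_minus_0[OF subspace_span finite_span_singleton] card_span_singleton by simp
    ultimately show "(\<Sum>x\<in>{x \<in> S - {0}. y \<in> span {x}}. g y) = (real CARD('f) - 1) * g y" by simp
  qed
  finally show ?thesis by (simp add: sum_distrib_left)
qed

text \<open>Both sides decompose into sums over cosets \<open>u + B\<close> with nonzero
  \<open>u\<close> in \<open>A\<close>, and \<open>sum_over_lines\<close> applies to the function
  sending \<open>u\<close> to its coset sum.\<close>

lemma sum_over_pencil:
  fixes \<omega> :: "'v \<Rightarrow> real"
  assumes "subspace A" "subspace B" "A \<inter> B = {0}" "finite A"
  shows "(\<Sum>x\<in>A - {0}. sum \<omega> (span ({x} \<union> B)) - sum \<omega> B)
       = (real CARD('f) - 1) * (sum \<omega> (span (A \<union> B)) - sum \<omega> B)"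
proof -
  have "sum \<omega> (span ({x} \<union> B)) - sum \<omega> B = (\<Sum>u\<in>span {x} - {0}. \<Sum>y\<in>B. \<omega> (u + y))"
    if "x \<in> A - {0}" for x
  proof -
    have "span ({x} \<union> B) = span (span {x} \<union> B)"
      unfolding span_Un span_span ..
    moreover have "span {x} \<inter> B = {0}"
      using that assms(3) by (subst span_singleton_meets_iff[OF assms(2)]) auto
    ultimately show ?thesis
      using sum_span_Un[OF subspace_span assms(2), of "{x}" \<omega>] finite_span_singleton by simp
  qed
  then show ?thesis
    unfolding sum_span_Un[OF assms] by (simp add: sum_over_lines[OF assms(1,4)])
qed

lemma sum_swap_extensions:
  fixes g :: "'v \<Rightarrow> 'v set \<Rightarrow> real"
  assumes "finite V" "finite X"
  shows "(\<Sum>T\<in>extensions V B k U. \<Sum>y\<in>{y \<in> X. y \<in> T}. g y T)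
       = (\<Sum>y\<in>X. \<Sum>T\<in>extensions V B k (insert y U). g y T)"
  using sum.swap_restrict[of "extensions V B k U" X "\<lambda>T y. g y T" "\<lambda>T y. y \<in> T"]
    finite_extensions[OF assms(1)] assms(2)
  by (simp add: extensions_containing)

lemma sum_weight_extensions:
  fixes \<omega> :: "'v \<Rightarrow> real"
  assumes "finite V"
  shows "(\<Sum>T\<in>extensions V B k U. sum \<omega> T)
       = (\<Sum>y\<in>V. real (card (extensions V B k (insert y U))) * \<omega> y)"
proof -
  have "(\<Sum>T\<in>extensions V B k U. sum \<omega> T) = (\<Sum>T\<in>extensions V B k U. \<Sum>y\<in>{y \<in> V. y \<in> T}. \<omega> y)"
  proof (rule sum.cong[OF refl])
    fix T assume "T \<in> extensions V B k U"
    then have "{y \<in> V. y \<in> T} = T" by (auto simp: extensions_def)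
    then show "sum \<omega> T = (\<Sum>y\<in>{y \<in> V. y \<in> T}. \<omega> y)" by simp
  qed
  then show ?thesis by (simp add: sum_swap_extensions[OF assms assms])
qed

context
  fixes V B :: "'v set" and k n b :: nat
  assumes V: "finite V" "subspace V" "card V = CARD('f) ^ n"
    and B: "subspace B" "B \<subseteq> V" "card B = CARD('f) ^ b"
begin

lemma card_extensions_0: "real (card (extensions V B k {})) = ext_count n b k 0"
  using subspace_0[OF B(1)] by (intro card_extensions[OF V(1,2) B(1,2) _ _ V(3) B(3)]) auto

lemma card_extensions_1:
  assumes "x \<in> V" "x \<notin> B" "k \<ge> 1"
  shows "real (card (extensions V B k {x})) = ext_count n b k 1"
proof (rule card_extensions[OF V(1,2) B(1,2) _ _ V(3) B(3)])
  have x: "x \<noteq> 0" using assms(2) subspace_0[OF B(1)] by metis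
  show "span {x} \<inter> B = {0}" using span_singleton_meets_iff[OF B(1) x] assms(2) by simp
  show "card (span {x}) = CARD('f) ^ 1" using card_span_singleton[OF x] by simp
qed (use assms in auto)

lemma card_extensions_2:
  assumes "x \<in> V" "x \<notin> B" "y \<in> V" "y \<notin> span ({x} \<union> B)" "k \<ge> 2"
  shows "real (card (extensions V B k {y, x})) = ext_count n b k 2"
proof (rule card_extensions[OF V(1,2) B(1,2) _ _ V(3) B(3)])
  have x: "x \<noteq> 0" using assms(2) subspace_0[OF B(1)] by metis
  have "span {x} \<inter> B = {0}" using span_singleton_meets_iff[OF B(1) x] assms(2) by simp
  then show "span {y, x} \<inter> B = {0}" by (rule span_insert_disjoint[OF B(1) _ assms(4)])
  have "y \<notin> span {x}" using assms(4) span_mono[of "{x}" "{x} \<union> B"] by blast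
  then show "card (span {y, x}) = CARD('f) ^ 2"
    using card_span_singleton[OF x] by (simp add: card_span_insert power2_eq_square)
qed (use assms in auto)

text \<open>Nonzero vectors of \<open>B\<close> lie in no member of the family, and all vectors
  outside \<open>B\<close> lie in equally many. The zero vector lies in every member, whence
  \<open>\<omega> 0 = 0\<close>.\<close>

lemma sum_weight_all_extensions:
  fixes \<omega> :: "'v \<Rightarrow> real"
  assumes "\<omega> 0 = 0" "k \<ge> 1"
  shows "(\<Sum>T\<in>extensions V B k {}. sum \<omega> T) = ext_count n b k 1 * (sum \<omega> V - sum \<omega> B)"
proof -
  have B0: "real (card (extensions V B k {y})) * \<omega> y = 0" if "y \<in> B" for y
  proof (cases "y = 0")
    case False
    then have "extensions V B k {y} = {}" using that by (auto simp: extensions_def)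
    then show ?thesis by simp
  qed (simp add: assms)
  have "(\<Sum>T\<in>extensions V B k {}. sum \<omega> T) = (\<Sum>y\<in>V. real (card (extensions V B k {y})) * \<omega> y)"
    by (rule sum_weight_extensions[OF V(1)])
  also have "\<dots> = (\<Sum>y\<in>V - B. real (card (extensions V B k {y})) * \<omega> y)"
    using sum.subset_diff[OF B(2) V(1), of "\<lambda>y. real (card (extensions V B k {y})) * \<omega> y"] B0 by simp
  also have "\<dots> = (\<Sum>y\<in>V - B. ext_count n b k 1 * \<omega> y)"
    using card_extensions_1[OF _ _ assms(2)] by (intro sum.cong) auto
  also have "\<dots> = ext_count n b k 1 * (sum \<omega> V - sum \<omega> B)"
    using sum.subset_diff[OF B(2) V(1), of \<omega>] by (simp add: sum_distrib_left[symmetric])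
  finally show ?thesis .
qed

text \<open>Vectors of \<open>span {x}\<close> lie in every \<open>T\<close>, the other vectors of
  \<open>span ({x} \<union> B)\<close> in none, and each remaining one in
  \<open>ext_count n b k 2\<close> of them.\<close>

lemma sum_weight_extensions_through:
  fixes \<omega> :: "'v \<Rightarrow> real"
  assumes x: "x \<in> V" "x \<notin> B" and k: "k \<ge> 2"
  shows "(\<Sum>T\<in>extensions V B k {x}. sum \<omega> T)
       = ext_count n b k 1 * sum \<omega> (span {x})
         + ext_count n b k 2 * (sum \<omega> V - sum \<omega> (span ({x} \<union> B)))"
proof -
  define W where "W = span ({x} \<union> B)"
  define N where "N y = real (card (extensions V B k {y, x})) * \<omega> y" for y
  have WV: "W \<subseteq> V" unfolding W_def
    by (rule span_minimal[OF _ V(2)]) (use x B(2) in auto)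
  have xW: "span {x} \<subseteq> W" unfolding W_def by (rule span_mono) simp
  have fW: "finite W" by (rule finite_subset[OF WV V(1)])
  have 1: "N y = ext_count n b k 1 * \<omega> y" if "y \<in> span {x}" for y
  proof -
    have "y \<in> T" if "T \<in> extensions V B k {x}" for T
      using that \<open>y \<in> span {x}\<close> span_minimal[of "{x}" T] by (auto simp: extensions_def)
    then have "extensions V B k {y, x} = extensions V B k {x}"
      using extensions_containing[of V B k "{x}" y] by blast
    then show ?thesis using card_extensions_1[OF x] k by (simp add: N_def)
  qed
  have 2: "N y = 0" if y: "y \<in> W - span {x}" for y
  proof -
    have "extensions V B k {y, x} = {}"
    proof (rule equals0I)
      fix T assume T: "T \<in> extensions V B k {y, x}"
      then have "T \<inter> W = span {x}"
        unfolding W_def by (intro inter_span_Un[OF B(1)]) (auto simp: extensions_def)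
      then show False using y T by (auto simp: extensions_def)
    qed
    then show ?thesis by (simp add: N_def)
  qed
  have 3: "N y = ext_count n b k 2 * \<omega> y" if "y \<in> V - W" for y
    using card_extensions_2[OF x _ _ k] that by (simp add: N_def W_def)
  have "(\<Sum>T\<in>extensions V B k {x}. sum \<omega> T) = sum N V"
    unfolding N_def by (rule sum_weight_extensions[OF V(1)])
  also have "\<dots> = sum N (V - W) + (sum N (W - span {x}) + sum N (span {x}))"
    by (simp add: sum.subset_diff[OF WV V(1)] sum.subset_diff[OF xW fW])
  also have "\<dots> = ext_count n b k 2 * sum \<omega> (V - W) + ext_count n b k 1 * sum \<omega> (span {x})"
    by (simp add: 1 2 3 sum_distrib_left)
  also have "sum \<omega> (V - W) = sum \<omega> V - sum \<omega> W"
    by (simp add: sum.subset_diff[OF WV V(1)])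
  finally show ?thesis by (simp add: W_def)
qed

end

subsection \<open>Intersections with a fixed subspace\<close>

lemma card_inter_nonzero:
  assumes "subspace T" "subspace A" "finite A"
  shows "real (card {x \<in> A - {0}. x \<in> T}) = real (card (T \<inter> A)) - 1"
proof -
  have "{x \<in> A - {0}. x \<in> T} = T \<inter> A - {0}" by blast
  then show ?thesis
    using card_subspace_minus_0[OF subspace_inter[OF assms(1,2)]] assms(3) by simp
qed

text \<open>Both sides count ordered pairs of independent vectors of \<open>T \<inter> A\<close>;
  for a trivial intersection both vanish. In particular the product is nonnegative.\<close>

lemma card_independent_pairs:
  assumes "subspace T" "subspace A" "finite A"
  shows "(\<Sum>x\<in>{x \<in> A - {0}. x \<in> T}. real (card {y \<in> A - span {x}. y \<in> T}))
       = (real (card (T \<inter> A)) - 1) * (real (card (T \<inter> A)) - real CARD('f))"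
proof -
  have TA: "subspace (T \<inter> A)" "finite (T \<inter> A)"
    using subspace_inter[OF assms(1,2)] assms(3) by simp_all
  have "real (card {y \<in> A - span {x}. y \<in> T}) = real (card (T \<inter> A)) - real CARD('f)"
    if x: "x \<in> A - {0}" "x \<in> T" for x
  proof -
    have sub: "span {x} \<subseteq> T \<inter> A"
      by (rule span_minimal[OF _ TA(1)]) (use x in simp)
    have "{y \<in> A - span {x}. y \<in> T} = T \<inter> A - span {x}" by blast
    then show ?thesis
      using card_Diff_subset[OF finite_span_singleton sub] card_mono[OF TA(2) sub]
        card_span_singleton[of x] x by (simp add: of_nat_diff)
  qed
  then have "(\<Sum>x\<in>{x \<in> A - {0}. x \<in> T}. real (card {y \<in> A - span {x}. y \<in> T}))
      = (\<Sum>x\<in>{x \<in> A - {0}. x \<in> T}. real (card (T \<inter> A)) - real CARD('f))"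
    by (intro sum.cong) auto
  then show ?thesis
    using card_inter_nonzero[OF assms] by simp
qed

context
  fixes V B A :: "'v set" and k n b :: nat
  assumes V: "finite V" "subspace V" "card V = CARD('f) ^ n"
    and B: "subspace B" "B \<subseteq> V" "card B = CARD('f) ^ b"
    and A: "subspace A" "A \<subseteq> V" "A \<inter> B = {0}"
    and k: "k \<ge> 2"
begin

text \<open>Because \<open>A\<close> avoids \<open>B\<close>, independent \<open>x\<close> and
  \<open>y\<close> in \<open>A\<close> satisfy \<open>y \<notin> span ({x} \<union> B)\<close>. So
  every such pair lies in the same number of \<open>T\<close>.\<close>

lemma sum_intersection_pairs:
  "(\<Sum>T\<in>extensions V B k {}. (real (card (T \<inter> A)) - 1) * (real (card (T \<inter> A)) - real CARD('f)))
   = (real (card A) - 1) * (real (card A) - real CARD('f)) * ext_count n b k 2"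
proof -
  have fA: "finite A" by (rule finite_subset[OF A(2) V(1)])
  have fB: "finite (A - {0})" "\<And>x. finite (A - span {x})" using fA by auto
  have "(\<Sum>T\<in>extensions V B k {}. (real (card (T \<inter> A)) - 1) * (real (card (T \<inter> A)) - real CARD('f)))
     = (\<Sum>T\<in>extensions V B k {}. \<Sum>x\<in>{x \<in> A - {0}. x \<in> T}. real (card {y \<in> A - span {x}. y \<in> T}))"
    using card_independent_pairs[OF _ A(1) fA] by (intro sum.cong) (auto simp: extensions_def)
  also have "\<dots> = (\<Sum>x\<in>A - {0}. \<Sum>T\<in>extensions V B k {x}. real (card {y \<in> A - span {x}. y \<in> T}))"
    by (rule sum_swap_extensions[OF V(1) fB(1)])
  also have "\<dots> = (\<Sum>x\<in>A - {0}. (real (card A) - real CARD('f)) * ext_count n b k 2)"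
  proof (rule sum.cong[OF refl])
    fix x assume x: "x \<in> A - {0}"
    have xVB: "x \<in> V" "x \<notin> B" using x A(2,3) by auto
    have AW: "A \<inter> span ({x} \<union> B) = span {x}"
      by (rule inter_span_Un[OF B(1) A(1,3)]) (use x in simp)
    have sub: "span {x} \<subseteq> A" using AW by blast
    have "(\<Sum>T\<in>extensions V B k {x}. real (card {y \<in> A - span {x}. y \<in> T}))
        = (\<Sum>y\<in>A - span {x}. real (card (extensions V B k {y, x})))"
      using sum_swap_extensions[OF V(1) fB(2), of "\<lambda>_ _. 1" _ B k "{x}"] by simp
    also have "\<dots> = (\<Sum>y\<in>A - span {x}. ext_count n b k 2)"
    proof (rule sum.cong[OF refl])
      fix y assume y: "y \<in> A - span {x}"
      have "y \<in> V" "y \<notin> span ({x} \<union> B)" using y A(2) AW by auto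
      then show "real (card (extensions V B k {y, x})) = ext_count n b k 2"
        by (rule card_extensions_2[OF V B xVB _ _ k])
    qed
    also have "\<dots> = (real (card A) - real CARD('f)) * ext_count n b k 2"
      using card_Diff_subset[OF finite_span_singleton sub] card_mono[OF fA sub]
        card_span_singleton[of x] x by (simp add: of_nat_diff)
    finally show "(\<Sum>T\<in>extensions V B k {x}. real (card {y \<in> A - span {x}. y \<in> T}))
        = (real (card A) - real CARD('f)) * ext_count n b k 2" .
  qed
  also have "\<dots> = (real (card A) - 1) * (real (card A) - real CARD('f)) * ext_count n b k 2"
    using card_subspace_minus_0[OF A(1) fA] by simp
  finally show ?thesis .
qed

text \<open>Swapping the sums leaves, for each nonzero \<open>x\<close> in \<open>A\<close>, the
  total weight of the \<open>T\<close> through \<open>x\<close>. Summing over \<open>x\<close> turns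
  the lines into \<open>A\<close> and the spaces \<open>span ({x} \<union> B)\<close> into a
  pencil.\<close>

lemma sum_weighted_intersections:
  fixes \<omega> :: "'v \<Rightarrow> real"
  assumes "\<omega> 0 = 0" "sum \<omega> V = 0"
  shows "(\<Sum>T\<in>extensions V B k {}. sum \<omega> T * (real (card (T \<inter> A)) - 1))
       = (real CARD('f) - 1) * ext_count n b k 1 * sum \<omega> A
         - ext_count n b k 2 * ((real (card A) - 1) * sum \<omega> B
             + (real CARD('f) - 1) * (sum \<omega> (span (A \<union> B)) - sum \<omega> B))"
proof -
  have fA: "finite A" by (rule finite_subset[OF A(2) V(1)])
  have fA0: "finite (A - {0})" using fA by simp
  have nz: "sum \<omega> (S - {0}) = sum \<omega> S" if "finite S" for S
    using sum_diff1[OF that, of \<omega> 0] assms(1) by simp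
  have "(\<Sum>T\<in>extensions V B k {}. sum \<omega> T * (real (card (T \<inter> A)) - 1))
      = (\<Sum>T\<in>extensions V B k {}. \<Sum>x\<in>{x \<in> A - {0}. x \<in> T}. sum \<omega> T)"
    using card_inter_nonzero[OF _ A(1) fA] by (intro sum.cong) (auto simp: extensions_def)
  also have "\<dots> = (\<Sum>x\<in>A - {0}. \<Sum>T\<in>extensions V B k {x}. sum \<omega> T)"
    by (rule sum_swap_extensions[OF V(1) fA0])
  also have "\<dots> = (\<Sum>x\<in>A - {0}. ext_count n b k 1 * (\<Sum>y\<in>span {x} - {0}. \<omega> y)
        - ext_count n b k 2 * (sum \<omega> B + (sum \<omega> (span ({x} \<union> B)) - sum \<omega> B)))"
  proof (rule sum.cong[OF refl])
    fix x assume x: "x \<in> A - {0}"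
    have xVB: "x \<in> V" "x \<notin> B" using x A(2,3) by auto
    show "(\<Sum>T\<in>extensions V B k {x}. sum \<omega> T) = ext_count n b k 1 * (\<Sum>y\<in>span {x} - {0}. \<omega> y)
        - ext_count n b k 2 * (sum \<omega> B + (sum \<omega> (span ({x} \<union> B)) - sum \<omega> B))"
      using sum_weight_extensions_through[OF V B xVB k, of \<omega>] nz[OF finite_span_singleton, of x] assms(2)
      by simp
  qed
  also have "\<dots> = ext_count n b k 1 * (\<Sum>x\<in>A - {0}. \<Sum>y\<in>span {x} - {0}. \<omega> y)
      - ext_count n b k 2 * (real (card (A - {0})) * sum \<omega> B
          + (\<Sum>x\<in>A - {0}. sum \<omega> (span ({x} \<union> B)) - sum \<omega> B))"
    by (simp only: sum_subtractf sum.distrib sum_distrib_left[symmetric] sum_constant)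
  also have "\<dots> = (real CARD('f) - 1) * ext_count n b k 1 * sum \<omega> A
         - ext_count n b k 2 * ((real (card A) - 1) * sum \<omega> B
             + (real CARD('f) - 1) * (sum \<omega> (span (A \<union> B)) - sum \<omega> B))"
    unfolding sum_over_lines[OF A(1) fA] sum_over_pencil[OF A(1) B(1) A(3) fA]
      card_subspace_minus_0[OF A(1) fA] nz[OF fA] by simp
  finally show ?thesis .
qed

end

section \<open>Estimates for counts and for sums over complements\<close>

lemma ext_count_pos:
  assumes "b + k \<le> n"
  shows "ext_count n b k j > 0"
  unfolding ext_count_def using assms
  by (intro prod_pos ballI divide_pos_pos) (simp_all add: power_q_less)

lemma ext_count_nonneg:
  assumes "b + k \<le> n"
  shows "ext_count n b k j \<ge> 0"
  using ext_count_pos[OF assms] by (rule less_imp_le)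

text \<open>The complements of \<open>B\<close> in \<open>span (A \<union> B)\<close> cover its vectors outside \<open>B\<close> uniformly.\<close>

lemma sum_span_Un_le:
  fixes \<omega> :: "'v \<Rightarrow> real"
  assumes V: "finite V" "subspace V"
    and B: "subspace B" "B \<subseteq> V" "card B = CARD('f) ^ k"
    and A: "subspace A" "A \<subseteq> V" "A \<inter> B = {0}" "card A = CARD('f) ^ k"
    and k: "k \<ge> 1" and "\<omega> 0 = 0"
    and M: "\<And>T. T \<in> extensions V B k {} \<Longrightarrow> sum \<omega> T \<le> M"
  shows "sum \<omega> (span (A \<union> B)) - sum \<omega> B \<le> real CARD('f) ^ k * M"
proof -
  define W where "W = span (A \<union> B)"
  have WV: "W \<subseteq> V" unfolding W_def by (rule span_minimal[OF _ V(2)]) (use A B in auto)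
  have W: "finite W" "subspace W" "card W = CARD('f) ^ (2 * k)"
    using finite_subset[OF WV V(1)] card_direct_sum[OF A(1) B(1) A(3)] A(4) B(3)
    by (simp_all add: W_def power_add mult_2)
  have BW: "B \<subseteq> W" unfolding W_def using span_superset by blast
  let ?Q = "real CARD('f) ^ k"
  have Q: "?Q - 1 > 0" using power_q_less[of 0 k] k by simp
  \<comment> \<open>The averaging identity is applied inside \<open>W\<close>, of dimension
    \<open>2 * k\<close>, in place of \<open>V\<close>.\<close>
  have "ext_count (2 * k) k k 1 * (sum \<omega> W - sum \<omega> B) = (\<Sum>T\<in>extensions W B k {}. sum \<omega> T)"
    using sum_weight_all_extensions[OF W B(1) BW B(3), of \<omega> k] \<open>\<omega> 0 = 0\<close> k by simp
  also have "\<dots> \<le> (\<Sum>T\<in>extensions W B k {}. M)"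
    using WV by (intro sum_mono M) (auto simp: extensions_def)
  also have "\<dots> = ext_count (2 * k) k k 0 * M"
    using card_extensions_0[OF W B(1) BW B(3), of k] by simp
  \<comment> \<open>The two counts differ by the factor
    \<open>(Q\<^sup>2 - Q) / (Q - 1) = Q\<close>, where \<open>Q\<close> is the size of
    \<open>B\<close>.\<close>
  also have "ext_count (2 * k) k k 0 = ?Q * ext_count (2 * k) k k 1"
  proof -
    have "ext_count (2 * k) k k 0 * (?Q - 1) = (?Q * ext_count (2 * k) k k 1) * (?Q - 1)"
      using ext_count_Suc[of 0 k "2 * k" k] k by (simp add: mult_2 power_add right_diff_distrib left_diff_distrib)
    then show ?thesis using Q by simp
  qed
  finally have "ext_count (2 * k) k k 1 * (sum \<omega> W - sum \<omega> B) \<le> ext_count (2 * k) k k 1 * (?Q * M)"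
    by (simp add: mult_ac)
  then show ?thesis
    using ext_count_pos[of k k "2 * k" 1] by (simp add: W_def)
qed

text \<open>Fix a point outside \<open>B\<close>. A \<open>k\<close>-space through it counted on the
  left meets \<open>B\<close> in at least \<open>CARD('f) - 1\<close> nonzero vectors, and each
  nonzero vector of \<open>B\<close> lies in \<open>ext_count n 0 k 2\<close> of the
  \<open>k\<close>-spaces through that point.\<close>

lemma ext_count_1_diff_le:
  assumes V: "finite V" "subspace V" "card V = CARD('f) ^ n"
    and B: "subspace B" "B \<subseteq> V" "card B = CARD('f) ^ b" "b < n"
    and k: "k \<ge> 2"
  shows "(ext_count n 0 k 1 - ext_count n b k 1) * (real CARD('f) - 1)
       \<le> (real CARD('f) ^ b - 1) * ext_count n 0 k 2"
proof -
  have fB: "finite B" by (rule finite_subset[OF B(2) V(1)])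
  have "card B < card V" using V(3) B(3,4) card_field_ge_2[where 'f='f] by simp
  then obtain x where x: "x \<in> V" "x \<notin> B" using B(2) by (metis less_irrefl subsetI subset_antisym)
  have x0: "x \<noteq> 0" using x subspace_0[OF B(1)] by metis
  have Z: "subspace {0}" "{0} \<subseteq> V" "card {0::'v} = CARD('f) ^ 0" "x \<notin> {0}"
    using subspace_0[OF V(2)] x0 by simp_all
  define E where "E = extensions V {0} k {x}"
  define E' where "E' = extensions V B k {x}"
  have fE: "finite E" unfolding E_def by (rule finite_extensions[OF V(1)])
  have sub: "E' \<subseteq> E"
    using subspace_0 by (auto simp: E_def E'_def extensions_def)
  have cE: "real (card E) = ext_count n 0 k 1" "real (card E') = ext_count n b k 1"
    using card_extensions_1[OF V Z(1-3) x(1) Z(4)] card_extensions_1[OF V B(1-3) x] k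
    by (simp_all add: E_def E'_def)
  have "(ext_count n 0 k 1 - ext_count n b k 1) * (real CARD('f) - 1)
      = (\<Sum>T\<in>E - E'. real CARD('f) - 1)"
    using card_Diff_subset[OF finite_subset[OF sub fE] sub] card_mono[OF fE sub] cE
    by (simp add: of_nat_diff)
  also have "\<dots> \<le> (\<Sum>T\<in>E - E'. real (card {y \<in> B - {0}. y \<in> T}))"
  proof (rule sum_mono)
    fix T assume T: "T \<in> E - E'"
    have T': "subspace T" "0 \<in> T \<inter> B" "T \<inter> B \<noteq> {0}"
      using T subspace_0[OF B(1)] subspace_0[of T] by (auto simp: E_def E'_def extensions_def)
    then obtain y where y: "y \<in> T \<inter> B" "y \<noteq> 0" by blast
    have "span {y} \<subseteq> T \<inter> B"
      by (rule span_minimal[OF _ subspace_inter[OF T'(1) B(1)]]) (use y in simp)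
    then have "span {y} - {0} \<subseteq> {y \<in> B - {0}. y \<in> T}" by blast
    then have "card (span {y} - {0}) \<le> card {y \<in> B - {0}. y \<in> T}"
      using fB by (intro card_mono) auto
    then show "real CARD('f) - 1 \<le> real (card {y \<in> B - {0}. y \<in> T})"
      using card_subspace_minus_0[OF subspace_span finite_span_singleton, of y] card_span_singleton[OF y(2)]
      by linarith
  qed
  also have "\<dots> \<le> (\<Sum>T\<in>E. real (card {y \<in> B - {0}. y \<in> T}))"
    using fE by (intro sum_mono2) auto
  also have "\<dots> = (\<Sum>y\<in>B - {0}. real (card (extensions V {0} k {y, x})))"
    using sum_swap_extensions[OF V(1), of "B - {0}" "\<lambda>_ _. 1" "{0}" k "{x}"] fB by (simp add: E_def)
  also have "\<dots> = (\<Sum>y\<in>B - {0}. ext_count n 0 k 2)"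
  proof (rule sum.cong[OF refl])
    fix y assume y: "y \<in> B - {0}"
    have "y \<notin> span {x}"
      using mem_span_singleton_commute[of x y] x0 y span_minimal[of "{y}" B] B(1) x(2) by auto
    moreover have "span ({x} \<union> {0}) = span {x}"
      using span_insert_0[of "{x}"] by (simp add: insert_commute)
    ultimately show "real (card (extensions V {0} k {y, x})) = ext_count n 0 k 2"
      using y B(2) by (intro card_extensions_2[OF V Z(1-3) x(1) Z(4) _ _ k]) auto
  qed
  also have "\<dots> = (real CARD('f) ^ b - 1) * ext_count n 0 k 2"
    using card_subspace_minus_0[OF B(1) fB] B(3) by simp
  finally show ?thesis .
qed

lemma ext_count_antimono:
  assumes "b + k \<le> n"
  shows "ext_count n b k j \<le> ext_count n 0 k j"
  unfolding ext_count_def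
proof (rule prod_mono, rule conjI)
  fix i assume i: "i \<in> {j..<k}"
  have "real CARD('f) ^ i \<le> real CARD('f) ^ (b + i)"
    using card_field_ge_2[where 'f='f] by (intro power_increasing) auto
  then show "(real CARD('f) ^ n - real CARD('f) ^ (b + i)) / (real CARD('f) ^ k - real CARD('f) ^ i)
      \<le> (real CARD('f) ^ n - real CARD('f) ^ (0 + i)) / (real CARD('f) ^ k - real CARD('f) ^ i)"
    using power_q_less[of i k] i by (intro divide_right_mono) auto
  show "0 \<le> (real CARD('f) ^ n - real CARD('f) ^ (b + i)) / (real CARD('f) ^ k - real CARD('f) ^ i)"
    using power_q_less[of i k] power_q_less[of "b + i" n] i assms by (intro divide_nonneg_nonneg) auto
qed

subsection \<open>Nonnegative subspaces\<close>

text \<open>A second-moment argument. With \<open>y T\<close> the number of nonzero vectors of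
  \<open>T \<inter> A\<close>, the weighted sum bounds the first moment over the nonnegative
  \<open>T\<close> from below, and the pair count bounds the excess from multiple intersections from
  above.\<close>

lemma card_nonneg_complements_ge:
  fixes \<omega> :: "'v \<Rightarrow> real"
  assumes V: "finite V" "subspace V" "card V = CARD('f) ^ n"
    and B: "subspace B" "B \<subseteq> V" "card B = CARD('f) ^ k"
    and k: "k \<ge> 2" "2 * k \<le> n"
    and \<omega>: "\<omega> 0 = 0" "sum \<omega> V = 0" "sum \<omega> B < 0"
  defines "p \<equiv> real CARD('f)"
  shows "(p - 1)\<^sup>2 * (ext_count n k k 1 - p ^ k * ext_count n k k 2)
           - (p ^ k - 1) * (p ^ k - p) * ext_count n k k 2
         \<le> real (card {T \<in> extensions V B k {}. sum \<omega> T \<ge> 0}) * (p - 1)\<^sup>2"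
proof -
  define E where "E = extensions V B k {}"
  define P where "P = {T \<in> E. sum \<omega> T \<ge> 0}"
  let ?m = "ext_count n k k 1" and ?m' = "ext_count n k k 2"
  have kn: "k + k \<le> n" using k by simp
  have fE: "finite E" unfolding E_def by (rule finite_extensions[OF V(1)])
  have p: "p \<ge> 2" using card_field_ge_2[where 'f='f] by (simp add: p_def)
  have cE: "real (card E) > 0"
    using card_extensions_0[OF V B] ext_count_pos[OF kn] by (simp add: E_def)
  then have "E \<noteq> {}" by auto
  then obtain A where AE: "A \<in> E" and max: "\<And>T. T \<in> E \<Longrightarrow> sum \<omega> T \<le> sum \<omega> A"
    using finite_has_max_value[OF fE] by metis
  have A: "subspace A" "A \<subseteq> V" "A \<inter> B = {0}" "card A = CARD('f) ^ k"
    using AE by (auto simp: E_def extensions_def)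
  define M where "M = sum \<omega> A"
  \<comment> \<open>The complements of \<open>B\<close> have positive total weight, because
    \<open>V\<close> has weight 0 and \<open>B\<close> negative weight.\<close>
  have M: "M > 0"
  proof -
    have "0 < ?m * (sum \<omega> V - sum \<omega> B)"
      using ext_count_pos[OF kn] \<omega> by (intro mult_pos_pos) auto
    also have "\<dots> = (\<Sum>T\<in>E. sum \<omega> T)"
      using sum_weight_all_extensions[OF V B, of \<omega> k] \<omega>(1) k by (simp add: E_def)
    also have "\<dots> \<le> real (card E) * M"
      using sum_bounded_above[of E "sum \<omega>" M] max by (simp add: M_def)
    finally show ?thesis using cE by (simp add: zero_less_mult_iff)
  qed
  have span_le: "sum \<omega> (span (A \<union> B)) - sum \<omega> B \<le> p ^ k * M"
    unfolding p_def using \<omega>(1) k max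
    by (intro sum_span_Un_le[OF V(1,2) B A]) (auto simp: E_def M_def)
  define y where "y T = real (card (T \<inter> A)) - 1" for T
  have T_sub: "subspace T" if "T \<in> E" for T using that by (simp add: E_def extensions_def)
  have fA: "finite A" by (rule finite_subset[OF A(2) V(1)])
  have y0: "y T \<ge> 0" if "T \<in> E" for T
    using card_inter_nonzero[OF T_sub[OF that] A(1) fA] unfolding y_def by linarith
  have y2: "y T * (y T - (p - 1)) \<ge> 0" if "T \<in> E" for T
  proof -
    have "y T * (y T - (p - 1)) = (real (card (T \<inter> A)) - 1) * (real (card (T \<inter> A)) - real CARD('f))"
      by (simp add: y_def p_def)
    then show ?thesis
      by (simp add: sum_nonneg flip: card_independent_pairs[OF T_sub[OF that] A(1) fA])
  qed
  have first: "(p - 1) * (?m - p ^ k * ?m') \<le> (\<Sum>T\<in>P. y T)"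
  proof -
    \<comment> \<open>The negative weight of \<open>B\<close> only helps, and \<open>span_le\<close>
      controls the pencil; afterwards \<open>M > 0\<close> can be cancelled.\<close>
    have "?m' * ((p ^ k - 1) * sum \<omega> B + (p - 1) * (sum \<omega> (span (A \<union> B)) - sum \<omega> B))
        \<le> ?m' * (0 + (p - 1) * (p ^ k * M))"
    proof (intro mult_left_mono add_mono ext_count_nonneg[OF kn] span_le)
      show "(p ^ k - 1) * sum \<omega> B \<le> 0"
        using p \<omega>(3) by (intro mult_nonneg_nonpos) auto
    qed (use p in simp)
    then have "M * ((p - 1) * (?m - p ^ k * ?m'))
        \<le> (p - 1) * ?m * M - ?m' * ((p ^ k - 1) * sum \<omega> B + (p - 1) * (sum \<omega> (span (A \<union> B)) - sum \<omega> B))"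
      by (simp add: algebra_simps)
    also have "\<dots> = (\<Sum>T\<in>E. sum \<omega> T * y T)"
      using sum_weighted_intersections[OF V B A(1-3) k(1) \<omega>(1,2)] A(4)
      by (simp add: E_def y_def p_def M_def)
    also have "\<dots> \<le> M * (\<Sum>T\<in>P. y T)"
      unfolding P_def using fE y0 max by (intro sum_mult_indicator_bound) (auto simp: M_def)
    finally show ?thesis using M by simp
  qed
  have second: "(\<Sum>T\<in>P. y T * (y T - (p - 1))) \<le> (p ^ k - 1) * (p ^ k - p) * ?m'"
  proof -
    have "(\<Sum>T\<in>P. y T * (y T - (p - 1))) \<le> (\<Sum>T\<in>E. y T * (y T - (p - 1)))"
      using fE y2 by (intro sum_mono2) (auto simp: P_def)
    also have "\<dots> = (p ^ k - 1) * (p ^ k - p) * ?m'"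
      using sum_intersection_pairs[OF V B A(1-3) k(1)] A(4) by (simp add: E_def y_def p_def)
    finally show ?thesis .
  qed
  have "(p - 1)\<^sup>2 * (?m - p ^ k * ?m') - (p ^ k - 1) * (p ^ k - p) * ?m'
      \<le> (p - 1) * (\<Sum>T\<in>P. y T) - (\<Sum>T\<in>P. y T * (y T - (p - 1)))"
  proof (rule diff_mono[OF _ second])
    show "(p - 1)\<^sup>2 * (?m - p ^ k * ?m') \<le> (p - 1) * (\<Sum>T\<in>P. y T)"
      unfolding power2_eq_square mult.assoc using p by (intro mult_left_mono[OF first]) simp
  qed
  also have "\<dots> = (\<Sum>T\<in>P. (p - 1) * y T - y T * (y T - (p - 1)))"
    by (simp add: sum_subtractf sum_distrib_left)
  also have "\<dots> \<le> (\<Sum>T\<in>P. (p - 1)\<^sup>2)"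
  proof (rule sum_mono)
    fix T
    \<comment> \<open>The difference of the two sides is this square. It vanishes when
      \<open>T\<close> meets \<open>A\<close> in exactly one point.\<close>
    have "0 \<le> (y T - (p - 1))\<^sup>2" by simp
    then show "(p - 1) * y T - y T * (y T - (p - 1)) \<le> (p - 1)\<^sup>2"
      by (simp add: power2_eq_square algebra_simps)
  qed
  finally show ?thesis by (simp add: P_def E_def)
qed

text \<open>As \<open>V\<close> has weight 0, the total over all \<open>k\<close>-spaces through
  \<open>v\<close> is the weight of \<open>span {v}\<close> times the difference of the two counts.
  By \<open>le\<close> no single one exceeds the weight of \<open>span {v}\<close> times the number
  of points of a \<open>k\<close>-space.\<close>

lemma card_nonneg_subspaces_through_ge:
  fixes \<omega> :: "'v \<Rightarrow> real"
  assumes V: "finite V" "subspace V" "card V = CARD('f) ^ n"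
    and k: "k \<ge> 2" and v: "v \<in> V" "v \<noteq> 0"
    and \<omega>: "sum \<omega> V = 0" "sum \<omega> (span {v}) > 0"
    and le: "\<And>T. T \<in> extensions V {0} k {v} \<Longrightarrow>
        (real CARD('f) - 1) * sum \<omega> T \<le> (real CARD('f) ^ k - 1) * sum \<omega> (span {v})"
  shows "(ext_count n 0 k 1 - ext_count n 0 k 2) * (real CARD('f) - 1)
       \<le> real (card {T \<in> extensions V {0} k {v}. sum \<omega> T \<ge> 0}) * (real CARD('f) ^ k - 1)"
proof -
  let ?p = "real CARD('f)" and ?E = "extensions V {0} k {v}" and ?m = "sum \<omega> (span {v})"
  have p: "?p - 1 > 0" using card_field_ge_2[where 'f='f] by simp
  have Z: "subspace {0}" "{0} \<subseteq> V" "card {0::'v} = CARD('f) ^ 0" "v \<notin> {0}"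
    using subspace_0[OF V(2)] v by simp_all
  have span0: "span ({v} \<union> {0}) = span {v}"
    using span_insert_0[of "{v}"] by (simp add: insert_commute)
  have "(\<Sum>T\<in>?E. sum \<omega> T) = ?m * (ext_count n 0 k 1 - ext_count n 0 k 2)"
    using sum_weight_extensions_through[OF V Z(1-3) v(1) Z(4) k, of \<omega>] \<omega>(1)
    unfolding span0 by (simp add: algebra_simps)
  then have "?m * ((ext_count n 0 k 1 - ext_count n 0 k 2) * (?p - 1)) = (\<Sum>T\<in>?E. ((?p - 1) * sum \<omega> T) * 1)"
    by (simp flip: sum_distrib_left)
  also have "\<dots> \<le> ((?p ^ k - 1) * ?m) * (\<Sum>T\<in>{T \<in> ?E. (?p - 1) * sum \<omega> T \<ge> 0}. 1)"
    using le by (intro sum_mult_indicator_bound finite_extensions[OF V(1)]) auto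
  also have "{T \<in> ?E. (?p - 1) * sum \<omega> T \<ge> 0} = {T \<in> ?E. sum \<omega> T \<ge> 0}"
    using p by (simp add: zero_le_mult_iff)
  finally have "?m * ((ext_count n 0 k 1 - ext_count n 0 k 2) * (?p - 1))
      \<le> ?m * (real (card {T \<in> ?E. sum \<omega> T \<ge> 0}) * (?p ^ k - 1))"
    by (simp add: mult_ac)
  then show ?thesis using \<omega>(2) by simp
qed

theorem card_nonneg_subspaces_ge:
  fixes \<omega> :: "'v \<Rightarrow> real"
  assumes V: "finite V" "subspace V" "card V = CARD('f) ^ n"
    and k: "k \<ge> 1" "4 * k \<le> n"
    and \<omega>: "\<omega> 0 = 0" "sum \<omega> V = 0"
  shows "ext_count n 0 k 1 \<le> real (card {T \<in> extensions V {0} k {}. sum \<omega> T \<ge> 0})"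
proof -
  define p where "p = real CARD('f)"
  define P where "P = {T \<in> extensions V {0} k {}. sum \<omega> T \<ge> 0}"
  have p: "p \<ge> 2" using card_field_ge_2[where 'f='f] by (simp add: p_def)
  have fP: "finite P" using finite_extensions[OF V(1)] by (simp add: P_def)
  have Z: "subspace {0}" "{0} \<subseteq> V" "card {0::'v} = CARD('f) ^ 0"
    using subspace_0[OF V(2)] by simp_all
  have "1 < card V" using V(3) k one_less_power[of "CARD('f)" n] card_field_ge_2[where 'f='f] by simp
  then have "V - {0} \<noteq> {}"
    using card_mono[of "{0}" V] by auto
  then obtain v where v: "v \<in> V - {0}"
    and max: "\<And>x. x \<in> V - {0} \<Longrightarrow> sum \<omega> (span {x}) \<le> sum \<omega> (span {v})"
    using finite_has_max_value[of "V - {0}" "\<lambda>x. sum \<omega> (span {x})"] V(1) by auto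
  have v': "v \<in> V" "v \<noteq> 0" "v \<notin> {0}" using v by auto
  define m where "m = sum \<omega> (span {v})"
  define E where "E = extensions V {0} k {v}"
  have E_sub: "E \<subseteq> extensions V {0} k {}" by (auto simp: E_def extensions_def)
  show ?thesis
  proof (cases "\<forall>T\<in>E. sum \<omega> T \<ge> 0")
    case True
    then have "E \<subseteq> P" using E_sub by (auto simp: P_def)
    then have "card E \<le> card P" by (rule card_mono[OF fP])
    moreover have "real (card E) = ext_count n 0 k 1"
      unfolding E_def by (rule card_extensions_1[OF V Z v'(1,3) k(1)])
    ultimately show ?thesis by (simp add: P_def)
  next
    case False
    then obtain B where BE: "B \<in> E" "sum \<omega> B < 0" by auto
    have B: "subspace B" "B \<subseteq> V" "card B = CARD('f) ^ k" "v \<in> B"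
      using BE by (auto simp: E_def extensions_def)
    have lines: "(p - 1) * sum \<omega> S = (\<Sum>x\<in>S - {0}. sum \<omega> (span {x}))" if S: "subspace S" "finite S" for S
    proof -
      have nz: "sum \<omega> (S - {0}) = sum \<omega> S" if "finite S" for S
        using sum_diff1[OF that, of \<omega> 0] \<omega>(1) by simp
      show ?thesis
        using sum_over_lines[OF S, of \<omega>] nz[OF S(2)] nz[OF finite_span_singleton] by (simp add: p_def)
    qed
    have fB: "finite B" by (rule finite_subset[OF B(2) V(1)])
    \<comment> \<open>Otherwise no line has positive weight, so enlarging \<open>B\<close> to
      \<open>V\<close> cannot raise the weight from negative to 0.\<close>
    have m: "m > 0"
    proof (rule ccontr)
      assume "\<not> m > 0"
      then have neg: "sum \<omega> (span {x}) \<le> 0" if "x \<in> V - {0}" for x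
        using max[OF that] by (simp add: m_def)
      have "0 = (\<Sum>x\<in>V - {0}. sum \<omega> (span {x}))"
        using lines[OF V(2,1)] \<omega>(2) by simp
      also have "\<dots> \<le> (\<Sum>x\<in>B - {0}. sum \<omega> (span {x}))"
      proof -
        have "B - {0} \<subseteq> V - {0}" "finite (V - {0})" using B(2) V(1) by auto
        from sum.subset_diff[OF this, of "\<lambda>x. sum \<omega> (span {x})"]
        show ?thesis using sum_nonpos[of "V - {0} - (B - {0})" "\<lambda>x. sum \<omega> (span {x})"] neg by simp
      qed
      also have "\<dots> = (p - 1) * sum \<omega> B" using lines[OF B(1) fB] by simp
      also have "\<dots> < 0" using p BE(2) by (intro mult_pos_neg) auto
      finally show False by simp
    qed
    \<comment> \<open>For \<open>k = 1\<close> the negative space \<open>B\<close> would be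
      \<open>span {v}\<close>, whose weight is \<open>m > 0\<close>.\<close>
    have k2: "k \<ge> 2"
    proof (rule ccontr)
      assume "\<not> k \<ge> 2"
      then have "k = 1" using k by simp
      have "span {v} \<subseteq> B" by (rule span_minimal[OF _ B(1)]) (use B in simp)
      then have "span {v} = B"
        using card_span_singleton[OF v'(2)] B(3) \<open>k = 1\<close> by (intro card_subset_eq[OF fB]) auto
      then show False using m BE(2) by (simp add: m_def)
    qed
    define P1 where "P1 = {T \<in> E. sum \<omega> T \<ge> 0}"
    define P2 where "P2 = {T \<in> extensions V B k {}. sum \<omega> T \<ge> 0}"
    have s: "(ext_count n 0 k 1 - ext_count n 0 k 2) * (p - 1) \<le> real (card P1) * (p ^ k - 1)"
      unfolding P1_def E_def p_def
    proof (rule card_nonneg_subspaces_through_ge[OF V k2 v'(1,2) \<omega>(2)])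
      show "sum \<omega> (span {v}) > 0" using m by (simp add: m_def)
      fix T assume "T \<in> extensions V {0} k {v}"
      then have T: "subspace T" "T \<subseteq> V" "card T = CARD('f) ^ k" by (auto simp: extensions_def)
      have fT: "finite T" by (rule finite_subset[OF T(2) V(1)])
      have "(p - 1) * sum \<omega> T = (\<Sum>x\<in>T - {0}. sum \<omega> (span {x}))" by (rule lines[OF T(1) fT])
      also have "\<dots> \<le> (\<Sum>x\<in>T - {0}. m)"
        unfolding m_def using T(2) by (intro sum_mono max) auto
      also have "\<dots> = (p ^ k - 1) * m"
        using card_subspace_minus_0[OF T(1) fT] T(3) by (simp add: p_def)
      finally show "(real CARD('f) - 1) * sum \<omega> T \<le> (real CARD('f) ^ k - 1) * sum \<omega> (span {v})"
        by (simp add: p_def m_def)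
    qed
    have t: "(p - 1)\<^sup>2 * (ext_count n k k 1 - p ^ k * ext_count n k k 2)
           - (p ^ k - 1) * (p ^ k - p) * ext_count n k k 2 \<le> real (card P2) * (p - 1)\<^sup>2"
      unfolding P2_def p_def using k
      by (intro card_nonneg_complements_ge[OF V B(1-3) k2 _ \<omega> BE(2)]) simp
    have "ext_count n 0 k 1 \<le> real (card P1) + real (card P2)"
    proof (rule count_bounds_combine[OF p _ _ _ _ _ _ s t])
      show "p < p ^ k" using power_q_less[of 1 k] k2 by (simp add: p_def)
      show "(p ^ k) ^ 4 \<le> p ^ n"
        unfolding power_mult[symmetric] using p k by (intro power_increasing) auto
      show "0 \<le> ext_count n 0 k 2" using k by (intro ext_count_nonneg) simp
      show "ext_count n k k 2 \<le> ext_count n 0 k 2" using k by (intro ext_count_antimono) simp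
      show "ext_count n 0 k 1 * (p ^ k - p) = (p ^ n - p) * ext_count n 0 k 2"
        using ext_count_Suc[of 1 k n 0] k2 by (simp add: p_def numeral_2_eq_2)
      show "(ext_count n 0 k 1 - ext_count n k k 1) * (p - 1) \<le> (p ^ k - 1) * ext_count n 0 k 2"
        unfolding p_def using k by (intro ext_count_1_diff_le[OF V B(1-3) _ k2]) simp
    qed
    also have "\<dots> = real (card (P1 \<union> P2))"
    proof -
      \<comment> \<open>Members of \<open>P1\<close> share the nonzero vector \<open>v\<close> with
        \<open>B\<close>, members of \<open>P2\<close> meet \<open>B\<close> trivially.\<close>
      have "P1 \<inter> P2 = {}"
        using B(4) v'(2) by (auto simp: P1_def P2_def E_def extensions_def)
      moreover have "finite P1" "finite P2"
        using finite_extensions[OF V(1)] by (simp_all add: P1_def P2_def E_def)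
      ultimately show ?thesis by (simp add: card_Un_disjoint)
    qed
    also have "\<dots> \<le> real (card P)"
    proof -
      have "extensions V B k {} \<subseteq> extensions V {0} k {}"
        using subspace_0 by (auto simp: extensions_def)
      then have "P1 \<union> P2 \<subseteq> P" using E_sub by (auto simp: P_def P1_def P2_def)
      then show ?thesis using card_mono[OF fP] by simp
    qed
    finally show ?thesis by (simp add: P_def)
  qed
qed

section \<open>From weights of points to weights of vectors\<close>

text \<open>Grouping the nonzero vectors of \<open>S\<close> by the line they span puts
  \<open>CARD('f) - 1\<close> of them on each line.\<close>

lemma sum_vectors_eq_sum_lines:
  fixes w :: "'v set \<Rightarrow> real"
  assumes V: "finite V" and S: "subspace S" "S \<subseteq> V"
  shows "(\<Sum>x\<in>S. if x = 0 then 0 else w (span {x}))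
       = (real CARD('f) - 1) * (\<Sum>v\<in>{v \<in> subspaces_of_dim V 1. v \<subseteq> S}. w v)"
proof -
  define X where "X = {v \<in> subspaces_of_dim V 1. v \<subseteq> S}"
  have X: "v \<in> X \<longleftrightarrow> subspace v \<and> v \<subseteq> S \<and> card v = CARD('f)" for v
    using S(2) by (auto simp: X_def subspaces_of_dim_eq[OF V])
  have fS: "finite S" by (rule finite_subset[OF S(2) V])
  have fX: "finite X" by (rule finite_subset[of _ "Pow S"]) (use X fS in auto)
  have "(\<Sum>x\<in>S. if x = 0 then 0 else w (span {x})) = (\<Sum>x\<in>S - {0}. w (span {x}))"
    using fS by (intro sum.mono_neutral_cong_right) auto
  also have "\<dots> = (\<Sum>v\<in>X. \<Sum>x\<in>{x \<in> S - {0}. span {x} = v}. w (span {x}))"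
  proof (rule sum.group[symmetric])
    show "(\<lambda>x. span {x}) ` (S - {0}) \<subseteq> X"
    proof (rule image_subsetI)
      fix x assume "x \<in> S - {0}"
      then show "span {x} \<in> X"
        using span_minimal[OF _ S(1), of "{x}"] card_span_singleton[of x] by (simp add: X)
    qed
  qed (use fS fX in auto)
  also have "\<dots> = (\<Sum>v\<in>X. (real CARD('f) - 1) * w v)"
  proof (rule sum.cong[OF refl])
    fix v assume "v \<in> X"
    then have v: "subspace v" "v \<subseteq> S" "card v = CARD('f)" by (simp_all add: X)
    have fv: "finite v" by (rule finite_subset[OF v(2) fS])
    have "span {x} = v" if x: "x \<in> v" "x \<noteq> 0" for x
    proof (rule card_subset_eq[OF fv])
      show "span {x} \<subseteq> v" by (rule span_minimal[OF _ v(1)]) (use x in simp)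
      show "card (span {x}) = card v" using card_span_singleton[OF x(2)] v(3) by simp
    qed
    then have "{x \<in> S - {0}. span {x} = v} = v - {0}"
      using v(2) span_base[of _ "{_}"] by blast
    moreover have "(\<Sum>x\<in>{x \<in> S - {0}. span {x} = v}. w (span {x}))
        = (\<Sum>x\<in>{x \<in> S - {0}. span {x} = v}. w v)" by (rule sum.cong) auto
    ultimately show "(\<Sum>x\<in>{x \<in> S - {0}. span {x} = v}. w (span {x})) = (real CARD('f) - 1) * w v"
      using card_subspace_minus_0[OF v(1) fv] v(3) by simp
  qed
  finally show ?thesis by (simp add: X_def sum_distrib_left)
qed

lemma subspaces_of_dim_eq_extensions:
  assumes "finite V"
  shows "subspaces_of_dim V k = extensions V {0} k {}"
  using subspace_0 by (auto simp: subspaces_of_dim_eq[OF assms] extensions_def)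

end

theorem mainTheorem4:
  fixes scale :: "'f::{field,finite} \<Rightarrow> 'v::ab_group_add \<Rightarrow> 'v"
    and V :: "'v set"
    and w :: "'v set \<Rightarrow> real"
    and q k n :: nat
  assumes "primepow q"
    and "CARD('f) = q"
    and "k \<ge> 1"
    and "n \<ge> 4 * k"
    and "vector_space scale"
    and "module.subspace scale V"
    and "vector_space.dim scale V = n"
    and "(\<Sum>v\<in>vector_space.subspaces_of_dim scale V 1. w v) = 0"
  shows "real (card {S \<in> vector_space.subspaces_of_dim scale V k.
            (\<Sum>v\<in>{v \<in> vector_space.subspaces_of_dim scale V 1. v \<subseteq> S}. w v) \<ge> 0})
          \<ge> gauss_binomial q (n - 1) (k - 1)"
proof -
  interpret finite_field_space scale
    unfolding finite_field_space_def by (rule assms)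
  \<comment> \<open>Every nonzero vector receives the weight of its line, which multiplies the
    weight of each subspace by \<open>CARD('f) - 1 > 0\<close> and so preserves signs.\<close>
  define \<omega> where "\<omega> x = (if x = 0 then 0 else w (span {x}))" for x
  \<comment> \<open>Here \<open>n > 0\<close> rules out the default value 0 of \<open>dim\<close>,
    so \<open>V\<close> is finite.\<close>
  have cV: "card V = CARD('f) ^ n"
    using card_subspace_dim_pos[OF assms(6)] assms(3,4,7) by simp
  then have "card V > 0" by simp
  then have fV: "finite V" by (rule card_ge_0_finite)
  have q: "CARD('f) \<ge> 2" by (rule card_field_ge_2)
  have \<omega>_sum: "sum \<omega> S = (real CARD('f) - 1) * (\<Sum>v\<in>{v \<in> subspaces_of_dim V 1. v \<subseteq> S}. w v)"
    if "subspace S" "S \<subseteq> V" for S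
    unfolding \<omega>_def by (rule sum_vectors_eq_sum_lines[OF fV that])
  have "{v \<in> subspaces_of_dim V 1. v \<subseteq> V} = subspaces_of_dim V 1"
    by (auto simp: subspaces_of_dim_def)
  then have "sum \<omega> V = 0"
    using \<omega>_sum[OF assms(6) subset_refl] assms(8) by simp
  then have "ext_count n 0 k 1 \<le> real (card {T \<in> extensions V {0} k {}. sum \<omega> T \<ge> 0})"
    using assms(3,4) by (intro card_nonneg_subspaces_ge[OF fV assms(6) cV]) (simp_all add: \<omega>_def)
  also have "{T \<in> extensions V {0} k {}. sum \<omega> T \<ge> 0}
      = {S \<in> subspaces_of_dim V k. (\<Sum>v\<in>{v \<in> subspaces_of_dim V 1. v \<subseteq> S}. w v) \<ge> 0}"
  proof (rule Collect_cong, rule conj_cong)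
    fix S
    show "S \<in> extensions V {0} k {} \<longleftrightarrow> S \<in> subspaces_of_dim V k"
      by (simp add: subspaces_of_dim_eq_extensions[OF fV])
    assume "S \<in> subspaces_of_dim V k"
    then have "subspace S" "S \<subseteq> V" by (auto simp: subspaces_of_dim_def)
    from \<omega>_sum[OF this]
    show "sum \<omega> S \<ge> 0 \<longleftrightarrow> (\<Sum>v\<in>{v \<in> subspaces_of_dim V 1. v \<subseteq> S}. w v) \<ge> 0"
      using q by (simp add: zero_le_mult_iff)
  qed
  finally show ?thesis
    using gauss_binomial_eq_prod[of k n q] assms(2,3,4) q by (simp add: ext_count_def)
qed

end
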